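(* Let $N$ be a finite set with $|N|\geq 2$ and let $\mathcal{S}$ be a non-trivial set system on $N$. Then $\mathcal{S}$ is semi-balanced if and only if $\mathcal{S}^{\star}$ is semi-balanced, and $\Theta_{\mathcal{S}^{\star}}=\{\theta^{\star}:\theta\in\Theta_{\mathcal{S}}\}$. Likewise, $\mathcal{S}$ is balanced if and only if $\mathcal{S}^{\star}$ is balanced. In particular, $\mathcal{S}$ is min-semi-balanced if and only if $\mathcal{S}^{\star}$ is min-semi-balanced, and $\mathcal{S}$ is min-balanced if and only if $\mathcal{S}^{\star}$ is min-balanced; if $\mathcal{S}$ is min-semi-balanced then $(\theta_{\mathcal{S}})^{\star}=\theta_{\mathcal{S}^{\star}}$. Moreover, given $\theta\in\mathbb{R}^{\mathcal{P}(N)}$ with $\sum_{S\subseteq N}\theta(S)=0$ and $\sum_{L:\,\emptyset\neq L\subset N}\theta(L)=-1$, the inequality $0\leq\langle\theta,m\rangle$ is facet-defining for $\mathcal{E}(N)$ if and only if its conjugate inequality $0\leq\langle\theta^{\star},m\rangle$ is facet-defining for $\mathcal{E}(N)$.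
   Context: $\mathcal{P}(N)$ is the power set of $N$, $\subset$ is strict inclusion, and $\chi_S\in\mathbb{R}^N$ is the incidence vector of $S\subseteq N$. A constant vector in $\mathbb{R}^N$ is a vector $[r,\ldots,r]$, $r\in\mathbb{R}$. A linear combination is affine if its coefficients sum to $1$, conic if all coefficients are $\geq 0$, and semi-conic if at most one coefficient is strictly negative. A non-trivial set system on $N$ is a system $\mathcal{S}$ with $\emptyset\neq\mathcal{S}\subseteq\mathcal{P}(N)\setminus\{\emptyset,N\}$. It is balanced (on $N$) if $\chi_N$ is a conic combination of $\{\chi_S:S\in\mathcal{S}\}$ with all coefficients non-zero. It is semi-balanced (on $N$) if some constant vector in $\mathbb{R}^N$ is a semi-conic combination of $\{\chi_S:S\in\mathcal{S}\}$ with all coefficients non-zero. It is min-balanced (min-semi-balanced) if it is balanced (semi-balanced) and has no strict subsystem that is balanced (semi-balanced) on $N$. The complementary system is $\mathcal{S}^{\star}:=\{N\setminus S:S\in\mathcal{S}\}$. For $\theta\in\mathbb{R}^{\mathcal{P}(N)}$ put $\theta^{\star}(L):=\theta(N\setminus L)$, $L\subseteq N$. For a non-trivial set system $\mathcal{S}$ on $N$, any affine semi-conic combination $\sum_{S\in\mathcal{S}}\lambda_S\chi_S$ (zero coefficients allowed) yielding a constant vector $[r,\ldots,r]$ is assigned the vector $\theta\in\mathbb{R}^{\mathcal{P}(N)}$ with $\theta(S)=-\lambda_S$ for $S\in\mathcal{S}$, $\theta(N)=r$, $\theta(\emptyset)=1-r$, and $\theta(L)=0$ for other $L\subseteq N$.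 $\Theta_{\mathcal{S}}$ is the set of all such $\theta$. If $|\Theta_{\mathcal{S}}|=1$ (which holds for min-semi-balanced $\mathcal{S}$), its only element is $\theta_{\mathcal{S}}$. A game over $N$ is $m\in\mathbb{R}^{\mathcal{P}(N)}$ with $m(\emptyset)=0$. Its core is $C(m)=\{x\in\mathbb{R}^N:\sum_{i\in N}x_i=m(N),\ \sum_{i\in S}x_i\geq m(S)\ \forall S\subseteq N\}$. The game $m$ is exact if for each $S\subseteq N$ there is $x\in C(m)$ with $\sum_{i\in S}x_i=m(S)$. $\mathcal{E}(N)$ is the polyhedral cone of exact games, full-dimensional when regarded in $\mathbb{R}^{\mathcal{P}(N)\setminus\{\emptyset\}}$. Write $\langle\theta,m\rangle=\sum_{S\subseteq N}\theta(S)m(S)$. The inequality $0\leq\langle\theta,m\rangle$ is facet-defining for $\mathcal{E}(N)$ if it is valid on $\mathcal{E}(N)$ and $\{m\in\mathcal{E}(N):\langle\theta,m\rangle=0\}$ is a face of dimension $\dim\mathcal{E}(N)-1$. *)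

theory Defs
  imports "HOL-Analysis.Analysis"
begin

(* The ground set N is the universe of a finite type 'n.  Thus R^N is real ^ 'n, the power set
   of N is the type 'n set, R^{P(N)} is real ^ ('n set), and \<langle>\<theta>, m\<rangle> is the library inner product
   \<theta> \<bullet> m.  The constant vector [r,...,r] is vec r. *)

definition incidence :: "'n::finite set \<Rightarrow> real ^ 'n" where
  "incidence S = (\<chi> i. if i \<in> S then 1 else 0)"

definition nontrivial_system :: "'n::finite set set \<Rightarrow> bool" where
  "nontrivial_system \<S> \<longleftrightarrow> \<S> \<noteq> {} \<and> \<S> \<subseteq> Pow UNIV - {{}, UNIV}"

definition incidence_comb :: "'n::finite set set \<Rightarrow> ('n set \<Rightarrow> real) \<Rightarrow> real ^ 'n" where
  "incidence_comb \<S> c = (\<Sum>S\<in>\<S>. c S *\<^sub>R incidence S)"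

definition affine_coeffs :: "'n::finite set set \<Rightarrow> ('n set \<Rightarrow> real) \<Rightarrow> bool" where
  "affine_coeffs \<S> c \<longleftrightarrow> (\<Sum>S\<in>\<S>. c S) = 1"

definition conic_coeffs :: "'n::finite set set \<Rightarrow> ('n set \<Rightarrow> real) \<Rightarrow> bool" where
  "conic_coeffs \<S> c \<longleftrightarrow> (\<forall>S\<in>\<S>. c S \<ge> 0)"

definition semi_conic_coeffs :: "'n::finite set set \<Rightarrow> ('n set \<Rightarrow> real) \<Rightarrow> bool" where
  "semi_conic_coeffs \<S> c \<longleftrightarrow> card {S \<in> \<S>. c S < 0} \<le> 1"

(* Non-triviality is part of the next two definitions: otherwise the empty system would count
   as semi-balanced (the empty sum is the zero vector), and no system would be minimal. *)

definition balanced :: "'n::finite set set \<Rightarrow> bool" where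
  "balanced \<S> \<longleftrightarrow> nontrivial_system \<S> \<and>
     (\<exists>c. conic_coeffs \<S> c \<and> (\<forall>S\<in>\<S>. c S \<noteq> 0) \<and>
          incidence_comb \<S> c = incidence UNIV)"

definition semi_balanced :: "'n::finite set set \<Rightarrow> bool" where
  "semi_balanced \<S> \<longleftrightarrow> nontrivial_system \<S> \<and>
     (\<exists>c r. semi_conic_coeffs \<S> c \<and> (\<forall>S\<in>\<S>. c S \<noteq> 0) \<and>
          incidence_comb \<S> c = vec r)"

definition min_balanced :: "'n::finite set set \<Rightarrow> bool" where
  "min_balanced \<S> \<longleftrightarrow> balanced \<S> \<and> (\<forall>\<T>. \<T> \<subset> \<S> \<longrightarrow> \<not> balanced \<T>)"

definition min_semi_balanced :: "'n::finite set set \<Rightarrow> bool" where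
  "min_semi_balanced \<S> \<longleftrightarrow> semi_balanced \<S> \<and> (\<forall>\<T>. \<T> \<subset> \<S> \<longrightarrow> \<not> semi_balanced \<T>)"

definition compl_system :: "'n::finite set set \<Rightarrow> 'n set set" where
  "compl_system \<S> = (\<lambda>S. UNIV - S) ` \<S>"

definition conj_vec :: "real ^ ('n::finite set) \<Rightarrow> real ^ ('n set)" where
  "conj_vec \<theta> = (\<chi> L. \<theta> $ (UNIV - L))"

definition Theta :: "'n::finite set set \<Rightarrow> (real ^ ('n set)) set" where
  "Theta \<S> = {\<theta>. \<exists>c r. affine_coeffs \<S> c \<and> semi_conic_coeffs \<S> c \<and>
       incidence_comb \<S> c = vec r \<and>
       (\<forall>S\<in>\<S>. \<theta> $ S = - c S) \<and> \<theta> $ UNIV = r \<and> \<theta> $ {} = 1 - r \<and>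
       (\<forall>L. L \<notin> \<S> \<and> L \<noteq> {} \<and> L \<noteq> UNIV \<longrightarrow> \<theta> $ L = 0)}"

(* Meaningful only when Theta \<S> is a singleton, as for min-semi-balanced \<S>. *)
definition theta_of :: "'n::finite set set \<Rightarrow> real ^ ('n set)" where
  "theta_of \<S> = the_elem (Theta \<S>)"

definition game :: "real ^ ('n::finite set) \<Rightarrow> bool" where
  "game m \<longleftrightarrow> m $ {} = 0"

definition core :: "real ^ ('n::finite set) \<Rightarrow> (real ^ 'n) set" where
  "core m = {x. (\<Sum>i\<in>UNIV. x $ i) = m $ UNIV \<and> (\<forall>S. (\<Sum>i\<in>S. x $ i) \<ge> m $ S)}"

definition exact_games :: "(real ^ ('n::finite set)) set" where
  "exact_games = {m. game m \<and> (\<forall>S. \<exists>x\<in>core m. (\<Sum>i\<in>S. x $ i) = m $ S)}"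

(* The coordinate of the empty set is kept in the ambient space; it is 0 on all games, so
   dimensions agree with those taken in R^{P(N) - {\<emptyset>}}.  The relation facet_of asks for a
   non-empty face of dimension one less; since the zero game is exact, non-emptiness is
   automatic here. *)
definition facet_defining :: "real ^ ('n::finite set) \<Rightarrow> bool" where
  "facet_defining \<theta> \<longleftrightarrow> (\<forall>m\<in>exact_games. 0 \<le> \<theta> \<bullet> m) \<and>
     {m \<in> exact_games. \<theta> \<bullet> m = 0} facet_of exact_games"

end

theory Submission
  imports Defs
begin

text \<open>
  Complementation turns a combination of the incidence vectors of \<open>\<S>\<close> with constant value \<open>r\<close>
  into a combination for the complementary system, with the same coefficients and constant value
  \<open>(\<Sum> c) - r\<close>.  For the exact games, minus the core of \<open>m\<close> is the core of the game
  \<open>S \<mapsto> m (N - S) - m N\<close>; this linear involution preserves the cone of exact games and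
  transports \<open>\<theta>\<close> to its conjugate as soon as the entries of \<open>\<theta>\<close> sum to zero.
\<close>

section \<open>Complementary systems\<close>

lemma inj_compl: "inj_on (\<lambda>S. UNIV - S) A"
  by (rule inj_onI) blast

lemma compl_system_idem [simp]: "compl_system (compl_system \<S>) = \<S>"
  by (auto simp: compl_system_def image_image double_diff)

lemma compl_system_iff: "L \<in> compl_system \<S> \<longleftrightarrow> UNIV - L \<in> \<S>"
  by (auto simp: compl_system_def image_iff double_diff)

text \<open>Used to carry minimality over: strict subsystems of a system and of its complement
  correspond.\<close>

lemma compl_system_psubset: "\<T> \<subset> \<S> \<Longrightarrow> compl_system \<T> \<subset> compl_system \<S>"
  unfolding psubset_eq by (metis compl_system_def compl_system_idem image_mono)

lemma nontrivial_compl_system: "nontrivial_system \<S> \<Longrightarrow> nontrivial_system (compl_system \<S>)"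
  by (auto simp: nontrivial_system_def compl_system_def)

lemma sum_compl_system: "(\<Sum>S\<in>compl_system \<S>. f (UNIV - S)) = (\<Sum>S\<in>\<S>. f S)"
  by (simp add: compl_system_def sum.reindex[OF inj_compl] double_diff)

lemma incidence_compl: "incidence (UNIV - S) = vec 1 - incidence S"
  by (simp add: incidence_def vec_eq_iff)

lemma incidence_comb_nth: "incidence_comb \<S> c $ i = (\<Sum>S\<in>\<S>. if i \<in> S then c S else 0)"
  unfolding incidence_comb_def incidence_def
  by (simp add: sum_component if_distrib cong: if_cong)

lemma incidence_comb_compl:
  "incidence_comb (compl_system \<S>) (\<lambda>S. c (UNIV - S)) = vec (\<Sum>S\<in>\<S>. c S) - incidence_comb \<S> c"
proof -
  have "incidence_comb (compl_system \<S>) (\<lambda>S. c (UNIV - S))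
      = (\<Sum>S\<in>compl_system \<S>. c (UNIV - S) *\<^sub>R (vec 1 - incidence (UNIV - S)))"
    unfolding incidence_comb_def by (simp add: incidence_compl)
  also have "\<dots> = (\<Sum>S\<in>\<S>. c S *\<^sub>R (vec 1 - incidence S))"
    by (rule sum_compl_system[where f = "\<lambda>S. c S *\<^sub>R (vec 1 - incidence S)"])
  also have "\<dots> = vec (\<Sum>S\<in>\<S>. c S) - incidence_comb \<S> c"
    by (simp add: incidence_comb_def vec_eq_iff sum_component right_diff_distrib sum_subtractf)
  finally show ?thesis .
qed

lemma semi_conic_compl:
  "semi_conic_coeffs (compl_system \<S>) (\<lambda>S. c (UNIV - S)) \<longleftrightarrow> semi_conic_coeffs \<S> c"
proof -
  have "{S \<in> compl_system \<S>. c (UNIV - S) < 0} = compl_system {S \<in> \<S>. c S < 0}"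
    by (auto simp: compl_system_iff)
  then show ?thesis
    by (simp add: semi_conic_coeffs_def compl_system_def card_image[OF inj_compl])
qed

lemma semi_balanced_compl:
  assumes "semi_balanced \<S>"
  shows "semi_balanced (compl_system \<S>)"
proof -
  obtain c r where c: "nontrivial_system \<S>" "semi_conic_coeffs \<S> c" "\<forall>S\<in>\<S>. c S \<noteq> 0"
    "incidence_comb \<S> c = vec r"
    using assms unfolding semi_balanced_def by blast
  have "incidence_comb (compl_system \<S>) (\<lambda>S. c (UNIV - S)) = vec ((\<Sum>S\<in>\<S>. c S) - r)"
    by (simp add: incidence_comb_compl c vec_eq_iff)
  with c show ?thesis
    unfolding semi_balanced_def
    by (intro conjI exI[of _ "\<lambda>S. c (UNIV - S)"] exI)
      (auto simp: nontrivial_compl_system semi_conic_compl compl_system_iff)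
qed

text \<open>Complementing a combination with value 1 yields the constant
  \<open>(\<Sum>S\<in>\<S>. c S) - 1\<close>. Dividing by it gives a balanced combination, once it
  is known to be positive.\<close>

lemma balanced_compl:
  assumes "balanced \<S>"
  shows "balanced (compl_system \<S>)"
proof -
  obtain c where c: "nontrivial_system \<S>" "\<And>S. S \<in> \<S> \<Longrightarrow> c S > 0"
    "incidence_comb \<S> c = incidence UNIV"
    using assms unfolding balanced_def conic_coeffs_def by (metis order_le_less)
  obtain T where T: "T \<in> \<S>" "T \<noteq> UNIV"
    using c(1) by (auto simp: nontrivial_system_def)
  then obtain i where i: "i \<notin> T" by blast
  \<comment> \<open>Coordinate \<open>i\<close> collects only the sets containing \<open>i\<close>.
    The full sum also includes the positive \<open>c T\<close>, so it exceeds 1.\<close>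
  have *: "1 = (\<Sum>S\<in>\<S>. if i \<in> S then c S else 0)"
    using incidence_comb_nth[of \<S> c i] c(3) by (simp add: incidence_def)
  have "\<dots> < (\<Sum>S\<in>\<S>. c S)"
    using T i c(2) by (intro sum_strict_mono_ex1) (auto intro: less_imp_le)
  with * have pos: "(\<Sum>S\<in>\<S>. c S) - 1 > 0" (is "?k > 0") by simp
  have "incidence_comb (compl_system \<S>) (\<lambda>S. c (UNIV - S) / ?k)
      = inverse ?k *\<^sub>R incidence_comb (compl_system \<S>) (\<lambda>S. c (UNIV - S))"
    by (simp add: incidence_comb_def scaleR_sum_right field_simps)
  also have "\<dots> = incidence UNIV"
    using pos by (simp add: incidence_comb_compl c(3) vec_eq_iff incidence_def)
  finally have "incidence_comb (compl_system \<S>) (\<lambda>S. c (UNIV - S) / ?k) = incidence UNIV" .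
  moreover have "\<forall>S\<in>compl_system \<S>. c (UNIV - S) / ?k > 0"
    using c(2) pos by (simp add: compl_system_iff)
  ultimately show ?thesis
    unfolding balanced_def conic_coeffs_def
    by (intro conjI exI[of _ "\<lambda>S. c (UNIV - S) / ?k"] nontrivial_compl_system[OF c(1)])
      (blast intro: less_imp_le dest: less_imp_neq[THEN not_sym])+
qed

lemma semi_balanced_compl_iff: "semi_balanced (compl_system \<S>) \<longleftrightarrow> semi_balanced \<S>"
  using semi_balanced_compl by (metis compl_system_idem)

lemma balanced_compl_iff: "balanced (compl_system \<S>) \<longleftrightarrow> balanced \<S>"
  using balanced_compl by (metis compl_system_idem)

lemma min_semi_balanced_compl_iff:
  "min_semi_balanced (compl_system \<S>) \<longleftrightarrow> min_semi_balanced \<S>"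
  unfolding min_semi_balanced_def
  by (metis compl_system_idem compl_system_psubset semi_balanced_compl_iff)

lemma min_balanced_compl_iff: "min_balanced (compl_system \<S>) \<longleftrightarrow> min_balanced \<S>"
  unfolding min_balanced_def
  by (metis compl_system_idem compl_system_psubset balanced_compl_iff)

section \<open>Coefficient vectors\<close>

lemma conj_vec_idem [simp]: "conj_vec (conj_vec \<theta>) = \<theta>"
  by (simp add: conj_vec_def vec_eq_iff double_diff)

text \<open>For affine coefficients the complementary constant is \<open>1 - r\<close>, so the
  entries \<open>r\<close> at \<open>UNIV\<close> and \<open>1 - r\<close> at \<open>{}\<close>
  trade places, exactly as conjugation requires.\<close>

lemma conj_vec_Theta:
  assumes "\<theta> \<in> Theta \<S>"
  shows "conj_vec \<theta> \<in> Theta (compl_system \<S>)"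
proof -
  obtain c r where c: "affine_coeffs \<S> c" "semi_conic_coeffs \<S> c" "incidence_comb \<S> c = vec r"
    "\<forall>S\<in>\<S>. \<theta> $ S = - c S" "\<theta> $ UNIV = r" "\<theta> $ {} = 1 - r"
    "\<forall>L. L \<notin> \<S> \<and> L \<noteq> {} \<and> L \<noteq> UNIV \<longrightarrow> \<theta> $ L = 0"
    using assms unfolding Theta_def by blast
  have "affine_coeffs (compl_system \<S>) (\<lambda>S. c (UNIV - S))"
    using c(1) by (simp add: affine_coeffs_def sum_compl_system)
  moreover have "incidence_comb (compl_system \<S>) (\<lambda>S. c (UNIV - S)) = vec (1 - r)"
    using c(1) by (simp add: incidence_comb_compl c(3) affine_coeffs_def vec_eq_iff)
  moreover have "semi_conic_coeffs (compl_system \<S>) (\<lambda>S. c (UNIV - S))"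
    by (simp add: semi_conic_compl c)
  moreover have "conj_vec \<theta> $ L = 0" if "L \<notin> compl_system \<S>" "L \<noteq> {}" "L \<noteq> UNIV" for L
  proof -
    have "UNIV - L \<noteq> {}" "UNIV - L \<noteq> UNIV" using that by auto
    then show ?thesis using c(7) that(1) by (simp add: conj_vec_def compl_system_iff)
  qed
  ultimately show ?thesis
    unfolding Theta_def mem_Collect_eq
    using c(4-6)
    by (intro exI[of _ "\<lambda>S. c (UNIV - S)"] exI[of _ "1 - r"])
      (simp add: conj_vec_def compl_system_iff)
qed

lemma Theta_compl_system: "Theta (compl_system \<S>) = conj_vec ` Theta \<S>"
proof
  show "conj_vec ` Theta \<S> \<subseteq> Theta (compl_system \<S>)"
    using conj_vec_Theta by blast
  show "Theta (compl_system \<S>) \<subseteq> conj_vec ` Theta \<S>"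
    using conj_vec_Theta[of _ "compl_system \<S>"] by (metis compl_system_idem conj_vec_idem image_eqI subsetI)
qed

text \<open>This is why a non-zero semi-conic combination with constant value can be rescaled to an affine one.\<close>

lemma semi_conic_sum_pos:
  assumes nt: "nontrivial_system \<S>" and sc: "semi_conic_coeffs \<S> c"
    and r: "incidence_comb \<S> c = vec r" and nz: "U \<in> \<S>" "c U \<noteq> 0"
  shows "(\<Sum>S\<in>\<S>. c S) > 0"
proof (cases "\<exists>T\<in>\<S>. c T < 0")
  case False
  then show ?thesis
    using nz by (intro sum_pos2[of _ U]) (auto simp: not_less order_le_less)
next
  case True
  then obtain T where T: "T \<in> \<S>" "c T < 0" by blast
  have others: "c S \<ge> 0" if "S \<in> \<S>" "S \<noteq> T" for S
  proof (rule ccontr)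
    assume "\<not> c S \<ge> 0"
    then have "{S, T} \<subseteq> {S \<in> \<S>. c S < 0}" using T that by auto
    then have "card {S, T} \<le> card {S \<in> \<S>. c S < 0}" by (intro card_mono) auto
    with sc that show False by (simp add: semi_conic_coeffs_def)
  qed
  have val: "(\<Sum>S\<in>\<S>. if i \<in> S then c S else 0) = r" for i
    using incidence_comb_nth[of \<S> c i] r by simp
  \<comment> \<open>The sets missing \<open>i\<close> also have a constant total coefficient: the
    value of the complementary combination.\<close>
  have co: "(\<Sum>S\<in>\<S>. if i \<in> S then 0 else c S) = (\<Sum>S\<in>\<S>. c S) - r" for i
    unfolding val[of i, symmetric] sum_subtractf[symmetric] by (rule sum.cong) auto
  have "T \<noteq> {}" "T \<noteq> UNIV" using nt T by (auto simp: nontrivial_system_def)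
  \<comment> \<open>Neither the sum over sets missing \<open>i\<close> nor the one over sets
    containing \<open>j\<close> involves the negative \<open>c T\<close>, so both constants are
    nonnegative.\<close>
  then obtain i j where ij: "i \<in> T" "j \<notin> T" by blast
  have r0: "r \<ge> 0"
    unfolding val[of j, symmetric] using others ij by (intro sum_nonneg) auto
  have s0: "(\<Sum>S\<in>\<S>. c S) \<ge> r"
    using sum_nonneg[of \<S> "\<lambda>S. if i \<in> S then 0 else c S"] others ij co[of i] by fastforce
  show ?thesis
  proof (rule ccontr)
    assume "\<not> ?thesis"
    then have z: "r = 0" "(\<Sum>S\<in>\<S>. c S) = 0" using r0 s0 by auto
    \<comment> \<open>A set \<open>S\<close> other than \<open>T\<close> misses a point of
      \<open>T\<close> or contains a point outside \<open>T\<close>. Either way \<open>c S\<close>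
      occurs in a vanishing sum of nonnegative terms. The total is then just \<open>c T < 0\<close>,
      against \<open>z\<close>.\<close>
    have supp: "c S = 0" if S: "S \<in> \<S>" "S \<noteq> T" for S
    proof -
      consider a where "a \<in> T" "a \<notin> S" | b where "b \<notin> T" "b \<in> S"
        using S by blast
      then show ?thesis
      proof cases
        case 1
        have "\<forall>S\<in>\<S>. (if a \<in> S then 0 else c S) = 0"
          using co[of a] z others 1
          by (subst sum_nonneg_eq_0_iff[symmetric]) auto
        then show ?thesis using S 1 by auto
      next
        case 2
        have "\<forall>S\<in>\<S>. (if b \<in> S then c S else 0) = 0"
          using val[of b] z others 2
          by (subst sum_nonneg_eq_0_iff[symmetric]) auto
        then show ?thesis using S 2 by auto
      qed
    qed
    have "(\<Sum>S\<in>\<S>. c S) = c T + (\<Sum>S\<in>\<S> - {T}. c S)"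
      using T by (simp add: sum.remove)
    also have "\<dots> = c T" using supp by simp
    finally show False using z T by simp
  qed
qed

text \<open>Discarding zero coefficients leaves a semi-balanced subsystem, non-empty because of
  \<open>U\<close>. Minimality forbids it to be strict.\<close>

lemma min_semi_balanced_full_support:
  assumes min: "min_semi_balanced \<S>" and sc: "semi_conic_coeffs \<S> c"
    and r: "incidence_comb \<S> c = vec r" and nz: "U \<in> \<S>" "c U \<noteq> 0" and S: "S \<in> \<S>"
  shows "c S \<noteq> 0"
proof
  assume "c S = 0"
  define \<T> where "\<T> = {S \<in> \<S>. c S \<noteq> 0}"
  have "\<T> \<subset> \<S>" using S \<open>c S = 0\<close> by (auto simp: \<T>_def)
  moreover have "nontrivial_system \<T>"
    using min nz
    by (auto simp: \<T>_def min_semi_balanced_def semi_balanced_def nontrivial_system_def)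
  moreover have "incidence_comb \<T> c = vec r"
    unfolding r[symmetric] incidence_comb_def
    by (rule sum.mono_neutral_left) (auto simp: \<T>_def)
  moreover have "{S \<in> \<T>. c S < 0} = {S \<in> \<S>. c S < 0}" by (auto simp: \<T>_def)
  then have "semi_conic_coeffs \<T> c" using sc by (simp add: semi_conic_coeffs_def)
  ultimately have "semi_balanced \<T>" unfolding semi_balanced_def by (auto simp: \<T>_def)
  with min \<open>\<T> \<subset> \<S>\<close> show False by (simp add: min_semi_balanced_def)
qed

text \<open>Two different affine solutions would span a line containing a semi-conic solution with a
  zero coefficient but not all zero, contrary to
  \<open>min_semi_balanced_full_support\<close>.\<close>

lemma min_semi_balanced_affine_unique:
  assumes min: "min_semi_balanced \<S>" and c: "affine_coeffs \<S> c" "semi_conic_coeffs \<S> c"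
      "incidence_comb \<S> c = vec r"
    and d: "affine_coeffs \<S> d" "incidence_comb \<S> d = vec s" and S: "S \<in> \<S>"
  shows "d S = c S"
proof (rule ccontr)
  assume neq: "d S \<noteq> c S"
  define f where "f = (\<lambda>S. d S - c S)"
  define D where "D = {S \<in> \<S>. f S \<noteq> 0}"
  have "finite D" "D \<noteq> {}" using S neq by (auto simp: D_def f_def)
  then obtain T where T: "T \<in> D" and least: "\<And>S. S \<in> D \<Longrightarrow> \<bar>c T / f T\<bar> \<le> \<bar>c S / f S\<bar>"
    using arg_min_least[of D _ "\<lambda>S. \<bar>c S / f S\<bar>"] arg_min_if_finite(1)[of D "\<lambda>S. \<bar>c S / f S\<bar>"]
    by metis
  \<comment> \<open>Move along the line through \<open>c\<close> and \<open>d\<close> until the first coefficient vanishes; no other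
    coefficient changes its sign on the way.\<close>
  define t where "t = c T / f T"
  define e where "e = (\<lambda>S. c S - t * f S)"
  have "c S < 0" if "S \<in> \<S>" "e S < 0" for S
  proof (cases "S \<in> D")
    case True
    \<comment> \<open>By the choice of \<open>T\<close> the displacement \<open>t * f S\<close> is
      at most \<open>c S\<close> in absolute value, so \<open>e S\<close> can be negative only where
      \<open>c S\<close> already is.\<close>
    then have "\<bar>t\<bar> * \<bar>f S\<bar> \<le> \<bar>c S\<bar>"
      using least[OF True] by (simp add: t_def D_def abs_divide pos_le_divide_eq)
    then have "\<bar>t * f S\<bar> \<le> \<bar>c S\<bar>" by (simp add: abs_mult)
    then show ?thesis using that(2) by (auto simp: e_def)
  next
    case False
    then show ?thesis using that by (simp add: e_def D_def)
  qed
  then have "card {S \<in> \<S>. e S < 0} \<le> card {S \<in> \<S>. c S < 0}"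
    by (intro card_mono) auto
  then have sc: "semi_conic_coeffs \<S> e" using c(2) by (simp add: semi_conic_coeffs_def)
  have "incidence_comb \<S> e
      = incidence_comb \<S> c - t *\<^sub>R (incidence_comb \<S> d - incidence_comb \<S> c)"
    by (simp add: incidence_comb_def e_def f_def scaleR_sum_right algebra_simps
        sum.distrib sum_subtractf)
  then have const: "incidence_comb \<S> e = vec (r - t * (s - r))"
    using c(3) d(2) by (simp add: vec_eq_iff)
  \<comment> \<open>The line stays in the affine solutions since \<open>f\<close> sums to 0; hence
    \<open>e\<close> is not identically zero on \<open>\<S>\<close>.\<close>
  have "(\<Sum>S\<in>\<S>. e S) = 1"
    using c(1) d(1) by (simp add: e_def f_def affine_coeffs_def sum_subtractf flip: sum_distrib_left)
  then obtain U where "U \<in> \<S>" "e U \<noteq> 0"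
    by (metis sum.neutral zero_neq_one)
  moreover have "T \<in> \<S>" "e T = 0" using T by (auto simp: e_def t_def D_def)
  ultimately show False
    using min_semi_balanced_full_support[OF min sc const] by blast
qed

text \<open>Existence comes from dividing a semi-conic combination by its positive coefficient sum,
  uniqueness from \<open>min_semi_balanced_affine_unique\<close>. This makes \<open>theta_of\<close>
  well defined.\<close>

lemma min_semi_balanced_Theta:
  assumes "min_semi_balanced \<S>"
  shows "\<exists>\<theta>. Theta \<S> = {\<theta>}"
proof -
  obtain c r where nt: "nontrivial_system \<S>" and sc: "semi_conic_coeffs \<S> c"
    and nz: "\<forall>S\<in>\<S>. c S \<noteq> 0" and r: "incidence_comb \<S> c = vec r"
    using assms unfolding min_semi_balanced_def semi_balanced_def by blast
  obtain U where U: "U \<in> \<S>" using nt by (auto simp: nontrivial_system_def)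
  define k where "k = (\<Sum>S\<in>\<S>. c S)"
  have k: "k > 0" unfolding k_def using semi_conic_sum_pos[OF nt sc r U] nz U by blast
  define e where "e = (\<lambda>S. c S / k)"
  have e: "affine_coeffs \<S> e" "semi_conic_coeffs \<S> e"
    using k sc by (simp_all add: e_def affine_coeffs_def semi_conic_coeffs_def k_def
        divide_less_0_iff flip: sum_divide_distrib)
  have "incidence_comb \<S> e = inverse k *\<^sub>R incidence_comb \<S> c"
    by (simp add: incidence_comb_def e_def scaleR_sum_right field_simps)
  then have er: "incidence_comb \<S> e = vec (r / k)"
    using r by (simp add: vec_eq_iff field_simps)
  define \<theta> :: "real ^ ('a set)" where
    "\<theta> = (\<chi> L. if L \<in> \<S> then - e L else if L = UNIV then r / k
      else if L = {} then 1 - r / k else 0)"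
  have "{} \<notin> \<S>" "UNIV \<notin> \<S>" using nt by (auto simp: nontrivial_system_def)
  then have "\<theta> \<in> Theta \<S>"
    using e er unfolding Theta_def by (auto simp: \<theta>_def)
  moreover have "\<theta>1 = \<theta>2" if "\<theta>1 \<in> Theta \<S>" "\<theta>2 \<in> Theta \<S>" for \<theta>1 \<theta>2
  proof -
    obtain c r where c: "affine_coeffs \<S> c" "semi_conic_coeffs \<S> c" "incidence_comb \<S> c = vec r"
      "\<forall>S\<in>\<S>. \<theta>1 $ S = - c S" "\<theta>1 $ UNIV = r" "\<theta>1 $ {} = 1 - r"
      "\<forall>L. L \<notin> \<S> \<and> L \<noteq> {} \<and> L \<noteq> UNIV \<longrightarrow> \<theta>1 $ L = 0"
      using \<open>\<theta>1 \<in> Theta \<S>\<close> unfolding Theta_def by blast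
    obtain d s where d: "affine_coeffs \<S> d" "semi_conic_coeffs \<S> d" "incidence_comb \<S> d = vec s"
      "\<forall>S\<in>\<S>. \<theta>2 $ S = - d S" "\<theta>2 $ UNIV = s" "\<theta>2 $ {} = 1 - s"
      "\<forall>L. L \<notin> \<S> \<and> L \<noteq> {} \<and> L \<noteq> UNIV \<longrightarrow> \<theta>2 $ L = 0"
      using \<open>\<theta>2 \<in> Theta \<S>\<close> unfolding Theta_def by blast
    have eq: "d S = c S" if "S \<in> \<S>" for S
      using min_semi_balanced_affine_unique[OF assms c(1-3) d(1,3) that] .
    then have "incidence_comb \<S> d = incidence_comb \<S> c"
      by (simp add: incidence_comb_def)
    \<comment> \<open>Equal coefficients on \<open>\<S>\<close> force equal constants, which settles
      the entries at \<open>UNIV\<close> and \<open>{}\<close>.\<close>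
    then have "r = s" using c(3) d(3) by (simp add: vec_eq_iff)
    have "\<theta>1 $ L = \<theta>2 $ L" for L
      using c(4-7) d(4-7) eq \<open>r = s\<close> by (cases "L \<in> \<S>"; cases "L = {}"; cases "L = UNIV") simp_all
    then show ?thesis by (simp add: vec_eq_iff)
  qed
  ultimately show ?thesis by blast
qed

section \<open>Exact games\<close>

text \<open>On games the last summand vanishes; it makes the map an involution of the whole ambient
  space, and in particular injective.\<close>

definition reflect_game :: "real ^ ('n::finite set) \<Rightarrow> real ^ ('n set)" where
  "reflect_game m = (\<chi> S. m $ (UNIV - S) - m $ UNIV + m $ {})"

lemma reflect_game_idem [simp]: "reflect_game (reflect_game m) = m"
  by (simp add: reflect_game_def vec_eq_iff double_diff)

lemma linear_reflect_game: "linear reflect_game"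
  by (rule linearI) (simp_all add: reflect_game_def vec_eq_iff algebra_simps)

lemma inj_reflect_game: "inj reflect_game"
  by (metis injI reflect_game_idem)

text \<open>The reflection adds the same constant \<open>m $ {} - m $ UNIV\<close> to every entry,
  and \<open>\<theta>\<close> annihilates constants. Reindexing by complements does the
  rest.\<close>

lemma inner_reflect_game:
  fixes \<theta> :: "real ^ ('n::finite set)"
  assumes "(\<Sum>S\<in>UNIV. \<theta> $ S) = 0"
  shows "\<theta> \<bullet> reflect_game m = conj_vec \<theta> \<bullet> m"
proof -
  have "\<theta> \<bullet> reflect_game m
      = (\<Sum>S\<in>UNIV. \<theta> $ S * m $ (UNIV - S)) + (\<Sum>S\<in>UNIV. \<theta> $ S) * (m $ {} - m $ UNIV)"
    by (simp add: inner_vec_def reflect_game_def algebra_simps sum.distrib sum_subtractf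
        sum_distrib_left)
  also have "\<dots> = (\<Sum>S\<in>UNIV. \<theta> $ S * m $ (UNIV - S))" using assms by simp
  also have "\<dots> = (\<Sum>S\<in>UNIV. \<theta> $ (UNIV - S) * m $ S)"
    by (rule sum.reindex_bij_witness[of _ "\<lambda>S. UNIV - S" "\<lambda>S. UNIV - S"])
      (auto simp: double_diff)
  finally show ?thesis by (simp add: inner_vec_def conj_vec_def)
qed

lemma sum_Compl_eq:
  fixes x :: "real ^ 'n::finite"
  shows "(\<Sum>i\<in>UNIV - S. x $ i) = (\<Sum>i\<in>UNIV. x $ i) - (\<Sum>i\<in>S. x $ i)"
  by (rule sum_diff) auto

text \<open>A lower bound on the sum over \<open>UNIV - S\<close> is an upper bound on the sum over
  \<open>S\<close>, because the total is fixed; negation turns it back into a lower bound.\<close>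

lemma core_reflect_game:
  assumes "game m" "x \<in> core m"
  shows "- x \<in> core (reflect_game m)"
proof -
  have x: "(\<Sum>i\<in>UNIV. x $ i) = m $ UNIV" "(\<Sum>i\<in>UNIV - S. x $ i) \<ge> m $ (UNIV - S)" for S
    using assms(2) unfolding core_def by blast+
  have "(\<Sum>i\<in>S. x $ i) \<le> m $ UNIV - m $ (UNIV - S)" for S
    using x(1) x(2)[of S] by (simp add: sum_Compl_eq)
  then show ?thesis
    using assms(1) x(1)
    by (simp add: core_def reflect_game_def game_def sum_negf) (simp add: algebra_simps)
qed

text \<open>A core element of \<open>m\<close> that is tight at \<open>UNIV - S\<close> becomes,
  after negation, a core element of the reflected game that is tight at \<open>S\<close>.\<close>

lemma exact_reflect_game:
  assumes "m \<in> exact_games"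
  shows "reflect_game m \<in> exact_games"
proof -
  have g: "game m" using assms by (simp add: exact_games_def)
  have "\<exists>y\<in>core (reflect_game m). (\<Sum>i\<in>S. y $ i) = reflect_game m $ S" for S
  proof -
    obtain x where x: "x \<in> core m" "(\<Sum>i\<in>UNIV - S. x $ i) = m $ (UNIV - S)"
      using assms unfolding exact_games_def by blast
    have "(\<Sum>i\<in>UNIV. x $ i) = m $ UNIV" using x(1) by (simp add: core_def)
    then have "(\<Sum>i\<in>S. (- x) $ i) = reflect_game m $ S"
      using x(2) g by (simp add: sum_Compl_eq reflect_game_def game_def sum_negf)
    then show ?thesis using core_reflect_game[OF g x(1)] by blast
  qed
  moreover have "game (reflect_game m)"
    using g by (simp add: game_def reflect_game_def)
  ultimately show ?thesis by (simp add: exact_games_def)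
qed

text \<open>An injective linear map of the cone onto itself preserves faces and their dimensions,
  and it carries the zero set of \<open>\<theta>\<close> to that of its conjugate.\<close>

lemma facet_defining_conj:
  fixes \<theta> :: "real ^ ('n::finite set)"
  assumes sum: "(\<Sum>S\<in>UNIV. \<theta> $ S) = 0" and facet: "facet_defining \<theta>"
  shows "facet_defining (conj_vec \<theta>)"
proof -
  \<comment> \<open>A general \<open>P\<close> serves twice: the trivial predicate gives invariance
    of the cone, and vanishing of the conjugate functional gives the image of the face.\<close>
  have image: "reflect_game ` {m \<in> exact_games. P (reflect_game m)} = {m \<in> exact_games. P m}"
    for P :: "real ^ ('n set) \<Rightarrow> bool"
    by (auto simp: exact_reflect_game image_iff) (metis exact_reflect_game reflect_game_idem)
  have E: "reflect_game ` exact_games = (exact_games :: (real ^ ('n set)) set)"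
    using image[of "\<lambda>_. True"] by simp
  have F: "reflect_game ` {m \<in> exact_games. \<theta> \<bullet> m = 0} = {m \<in> exact_games. conj_vec \<theta> \<bullet> m = 0}"
    using image[of "\<lambda>m. conj_vec \<theta> \<bullet> m = 0"] by (simp flip: inner_reflect_game[OF sum])
  have "{m \<in> exact_games. \<theta> \<bullet> m = 0} facet_of exact_games"
    and valid: "\<And>m. m \<in> exact_games \<Longrightarrow> 0 \<le> \<theta> \<bullet> m"
    using facet by (auto simp: facet_defining_def)
  then have "reflect_game ` {m \<in> exact_games. \<theta> \<bullet> m = 0} facet_of reflect_game ` exact_games"
    by (simp add: facet_of_def face_of_linear_image[OF linear_reflect_game inj_reflect_game]
        aff_dim_injective_linear_image[OF linear_reflect_game inj_reflect_game])
  then show ?thesis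
    using valid exact_reflect_game
    unfolding facet_defining_def E F inner_reflect_game[OF sum, symmetric] by blast
qed

text \<open>Allows \<open>facet_defining_conj\<close> to be applied to the conjugate vector as well,
  which yields the converse direction.\<close>

lemma sum_conj_vec: "(\<Sum>S\<in>UNIV. conj_vec \<theta> $ S) = (\<Sum>S\<in>UNIV. \<theta> $ S)"
  by (rule sum.reindex_bij_witness[of _ "\<lambda>S. UNIV - S" "\<lambda>S. UNIV - S"])
    (auto simp: conj_vec_def double_diff)

theorem lemma11:
  fixes \<S> :: "'n::finite set set"
  assumes "CARD('n) \<ge> 2"
    and "nontrivial_system \<S>"
  shows "(semi_balanced \<S> \<longleftrightarrow> semi_balanced (compl_system \<S>))
    \<and> Theta (compl_system \<S>) = {conj_vec \<theta> | \<theta>. \<theta> \<in> Theta \<S>}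
    \<and> (balanced \<S> \<longleftrightarrow> balanced (compl_system \<S>))
    \<and> (min_semi_balanced \<S> \<longleftrightarrow> min_semi_balanced (compl_system \<S>))
    \<and> (min_balanced \<S> \<longleftrightarrow> min_balanced (compl_system \<S>))
    \<and> (min_semi_balanced \<S> \<longrightarrow> conj_vec (theta_of \<S>) = theta_of (compl_system \<S>))
    \<and> (\<forall>\<theta> :: real ^ ('n set).
         (\<Sum>S\<in>UNIV. \<theta> $ S) = 0 \<and> (\<Sum>L | {} \<noteq> L \<and> L \<subset> UNIV. \<theta> $ L) = -1
         \<longrightarrow> (facet_defining \<theta> \<longleftrightarrow> facet_defining (conj_vec \<theta>)))"
proof (intro conjI)
  show "min_semi_balanced \<S> \<longrightarrow> conj_vec (theta_of \<S>) = theta_of (compl_system \<S>)"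
  proof
    assume "min_semi_balanced \<S>"
    then obtain \<theta> where "Theta \<S> = {\<theta>}" using min_semi_balanced_Theta by blast
    then show "conj_vec (theta_of \<S>) = theta_of (compl_system \<S>)"
      by (simp add: theta_of_def Theta_compl_system)
  qed
  show "\<forall>\<theta> :: real ^ ('n set).
         (\<Sum>S\<in>UNIV. \<theta> $ S) = 0 \<and> (\<Sum>L | {} \<noteq> L \<and> L \<subset> UNIV. \<theta> $ L) = -1
         \<longrightarrow> (facet_defining \<theta> \<longleftrightarrow> facet_defining (conj_vec \<theta>))"
    by (metis conj_vec_idem facet_defining_conj sum_conj_vec)
qed (auto simp: semi_balanced_compl_iff balanced_compl_iff min_semi_balanced_compl_iff
    min_balanced_compl_iff Theta_compl_system)

end
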